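(* Let $\hat\beta$ be the Lasso estimator with tuning parameter $\lambda>0$, i.e. a minimizer over $\beta\in\mathbb{R}^p$ of $\|Y-X\beta\|_n^2+2\lambda\|\beta\|_1$, where $Y=X\beta^0+\epsilon$. Let $\lambda_\epsilon\ge\|\epsilon^TX\|_\infty/n$. Let $0\le\delta<1$ be arbitrary and, for $\lambda>\lambda_\epsilon$, define $$L:=\frac{\lambda+\lambda_\epsilon+\delta(\lambda-\lambda_\epsilon)}{(1-\delta)(\lambda-\lambda_\epsilon)},\qquad \lambda_*:=\lambda+\lambda_\epsilon+\delta(\lambda-\lambda_\epsilon).$$ Let $$\beta^*:=\arg\min\Big\{\|X(\beta-\beta^0)\|_n^2+\lambda_*^2|S_\beta|/\hat\phi^2(L,S_\beta):\ \|\beta\|_1\ge\|\beta^0\|_1\Big\}$$ and let $S_*$ be the active set of $\beta^*$. Then $$2\delta(\lambda-\lambda_\epsilon)\|\hat\beta-\beta^0\|_1+\|X(\hat\beta-\beta^0)\|_n^2\le\frac{\lambda+\lambda_\epsilon+3\delta(\lambda-\lambda_\epsilon)}{\lambda+\lambda_\epsilon+\delta(\lambda-\lambda_\epsilon)}\|X(\beta^*-\beta^0)\|_n^2$$ $$+\big(\lambda+\lambda_\epsilon+3\delta(\lambda-\lambda_\epsilon)\big)\big(\lambda+\lambda_\epsilon+\delta(\lambda-\lambda_\epsilon)\big)\frac{|S_*|}{\hat\phi^2(L,S_* )}.$$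
   Context: $X$ is a fixed $n\times p$ real matrix of rank $n$, $Y\in\mathbb{R}^n$, $f^0=\mathbb{E}Y$, $\beta^0\in\mathbb{R}^p$ is a solution of $X\beta^0=f^0$, and $\epsilon:=Y-f^0$, so $Y=X\beta^0+\epsilon$ (the result is deterministic: it holds for any realization of $\epsilon$). For $v\in\mathbb{R}^n$, $\|v\|_n:=\sqrt{v^Tv/n}$. For $\beta\in\mathbb{R}^p$, $S_\beta:=\{j:\beta_j\ne0\}$ is its active set. For $S\subset\{1,\dots,p\}$, $\beta_S\in\mathbb{R}^p$ has entries $\beta_j$ for $j\in S$ and $0$ otherwise. The compatibility constant, for $L>0$, is $$\hat\phi^2(L,S):=\min\{|S|\,\|X\beta_S-X\beta_{S^c}\|_n^2:\ \|\beta_S\|_1=1,\ \|\beta_{S^c}\|_1\le L\}.$$ Conventions: $|S|/\hat\phi^2(L,S)$ is $0$ if $S=\emptyset$ and $+\infty$ if $S\ne\emptyset$ and $\hat\phi(L,S)=0$. $\beta^*$ is any minimizer (assumed to exist). *)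

theory Defs
  imports "HOL-Analysis.Analysis"
begin

definition norm_n :: "real ^ 'n \<Rightarrow> real"
  where "norm_n v = sqrt ((v \<bullet> v) / real CARD('n))"

definition norm_l1 :: "real ^ 'p \<Rightarrow> real"
  where "norm_l1 b = (\<Sum>j\<in>UNIV. \<bar>b $ j\<bar>)"

definition active_set :: "real ^ 'p \<Rightarrow> 'p set"
  where "active_set b = {j. b $ j \<noteq> 0}"

definition restrict_vec :: "real ^ 'p \<Rightarrow> 'p set \<Rightarrow> real ^ 'p"
  where "restrict_vec b S = (\<chi> j. if j \<in> S then b $ j else 0)"

definition compat_values :: "real ^ 'p ^ 'n \<Rightarrow> real \<Rightarrow> 'p set \<Rightarrow> real set"
  where "compat_values X L S =
    {real (card S) * (norm_n (X *v restrict_vec b S - X *v restrict_vec b (- S)))\<^sup>2 | b.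
       norm_l1 (restrict_vec b S) = 1 \<and> norm_l1 (restrict_vec b (- S)) \<le> L}"

(* For S nonempty and L > 0 the infimum is a minimum, see compat_sq_attained below.
   For S empty there is no admissible vector and the value is unspecified. *)
definition compat_sq :: "real ^ 'p ^ 'n \<Rightarrow> real \<Rightarrow> 'p set \<Rightarrow> real"
  where "compat_sq X L S = Inf (compat_values X L S)"

(* The quotient |S| / phi^2(L, S), with its conventions for S empty and for phi(L, S) = 0. *)
definition compat_ratio :: "real ^ 'p ^ 'n \<Rightarrow> real \<Rightarrow> 'p set \<Rightarrow> ereal"
  where "compat_ratio X L S =
    (if S = {} then 0
     else if compat_sq X L S = 0 then \<infinity>
     else ereal (real (card S) / compat_sq X L S))"

definition is_lasso :: "real ^ 'p ^ 'n \<Rightarrow> real ^ 'n \<Rightarrow> real \<Rightarrow> real ^ 'p \<Rightarrow> bool"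
  where "is_lasso X Y lam bhat \<longleftrightarrow>
    is_arg_min (\<lambda>b. (norm_n (Y - X *v b))\<^sup>2 + 2 * lam * norm_l1 b) (\<lambda>b. True) bhat"

lemma compat_sq_attained:
  fixes X :: "real ^ 'p ^ 'n"
  assumes S: "S \<noteq> {}" and L: "L > 0"
  shows "compat_sq X L S \<in> compat_values X L S \<and> (\<forall>v \<in> compat_values X L S. compat_sq X L S \<le> v)"
proof -
  define K where "K = {b. norm_l1 (restrict_vec b S) = 1 \<and> norm_l1 (restrict_vec b (- S)) \<le> L}"
  define g where "g = (\<lambda>b::real ^ 'p. real (card S) *
    (norm_n (X *v restrict_vec b S - X *v restrict_vec b (- S)))\<^sup>2)"
  have vals: "compat_values X L S = g ` K"
    by (auto simp: compat_values_def K_def g_def)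
  have cr: "continuous_on UNIV (\<lambda>b::real ^ 'p. restrict_vec b T)" for T
  proof -
    have "continuous_on UNIV (\<lambda>b::real ^ 'p. if i \<in> T then b $ i else 0)" for i
      by (cases "i \<in> T") (auto intro!: continuous_intros)
    then show ?thesis
      unfolding restrict_vec_def by (intro continuous_on_vec_lambda)
  qed
  have cl: "continuous_on UNIV (\<lambda>b::real ^ 'p. norm_l1 (restrict_vec b T))" for T
    unfolding norm_l1_def by (intro continuous_intros cr)
  have cX: "continuous_on UNIV (\<lambda>b::real ^ 'p. X *v restrict_vec b T)" for T
    by (rule bounded_linear.continuous_on[OF matrix_vector_mul_bounded_linear cr])
  have cg: "continuous_on UNIV g"
    unfolding g_def norm_n_def by (intro continuous_intros cX) auto
  have closedK: "closed K"
  proof -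
    have "closed {b::real ^ 'p. norm_l1 (restrict_vec b S) = 1}"
      by (intro closed_Collect_eq cl continuous_intros)
    moreover have "closed {b::real ^ 'p. norm_l1 (restrict_vec b (- S)) \<le> L}"
      by (intro closed_Collect_le cl continuous_intros)
    moreover have "K = {b. norm_l1 (restrict_vec b S) = 1} \<inter> {b. norm_l1 (restrict_vec b (- S)) \<le> L}"
      by (auto simp: K_def)
    ultimately show ?thesis
      by auto
  qed
  have "norm b \<le> 1 + L" if "b \<in> K" for b
  proof -
    have "norm b \<le> norm_l1 b"
      unfolding norm_l1_def by (rule norm_le_l1_cart)
    also have "norm_l1 b = norm_l1 (restrict_vec b S) + norm_l1 (restrict_vec b (- S))"
      unfolding norm_l1_def restrict_vec_def sum.distrib[symmetric]
      by (intro sum.cong) auto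
    also have "\<dots> \<le> 1 + L"
      using that by (auto simp: K_def)
    finally show ?thesis .
  qed
  then have "bounded K"
    by (auto simp: bounded_iff)
  with closedK have compactK: "compact K"
    by (simp add: compact_eq_bounded_closed)
  obtain s where s: "s \<in> S" using S by blast
  have "norm_l1 (restrict_vec (axis s 1) S) = 1"
  proof -
    have "norm_l1 (restrict_vec (axis s 1) S) = (\<Sum>j\<in>UNIV. if j = s then 1 else 0)"
      unfolding norm_l1_def restrict_vec_def using s by (intro sum.cong) (auto simp: axis_def)
    then show ?thesis by simp
  qed
  moreover have "norm_l1 (restrict_vec (axis s 1) (- S)) = 0"
    unfolding norm_l1_def restrict_vec_def using s by (intro sum.neutral) (auto simp: axis_def)
  ultimately have "axis s 1 \<in> K"
    using L by (simp add: K_def)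
  then obtain b where b: "b \<in> K" and min: "\<forall>c\<in>K. g b \<le> g c"
    using continuous_attains_inf[OF compactK _ continuous_on_subset[OF cg subset_UNIV]] by blast
  have "Inf (g ` K) = g b"
    using b min by (intro cInf_eq_minimum) auto
  then show ?thesis
    using b min by (auto simp: compat_sq_def vals)
qed

end

theory Submission
  imports Defs
begin

text \<open>
  Put \<open>d = delta * (lam - lam_eps)\<close> and let \<open>S\<close> be the active set of \<open>b\<close>. Optimality of
  \<open>betahat\<close> on the segment towards \<open>b\<close> bounds \<open>(X(betahat - b) \<bullet> X(betahat - beta0)) / n\<close>. Either
  this inner product is at most \<open>- d * norm_l1 (betahat - b)\<close>, and the polarization identity is
  enough, or \<open>betahat - b\<close> satisfies the cone condition with constant \<open>L\<close>, and compatibility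
  controls its \<open>S\<close>-part. This bounds the error around \<open>b\<close> by
  \<open>E = \<parallel>X(b - beta0)\<parallel>^2 + lam_star^2 |S| / phi^2\<close>. The constraint \<open>norm_l1 beta0 \<le> norm_l1 b\<close> puts
  \<open>b - beta0\<close> in the cone with constant \<open>1 \<le> L\<close>, so compatibility also yields
  \<open>lam_star * norm_l1 (b - beta0) \<le> E\<close>, and the triangle inequality moves the center from \<open>b\<close> to
  \<open>beta0\<close>. The theorem is the case \<open>b = betastar\<close>.
\<close>

lemma norm_n_sq: "(norm_n (v :: real ^ 'n))\<^sup>2 = (v \<bullet> v) / real CARD('n)"
  unfolding norm_n_def by simp

lemma norm_l1_nonneg: "0 \<le> norm_l1 b"
  unfolding norm_l1_def by (simp add: sum_nonneg)

lemma norm_l1_triangle: "norm_l1 (a + b) \<le> norm_l1 a + norm_l1 b"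
  unfolding norm_l1_def sum.distrib[symmetric] by (intro sum_mono) simp

lemma norm_l1_scaleR: "norm_l1 (c *\<^sub>R b) = \<bar>c\<bar> * norm_l1 b"
  unfolding norm_l1_def by (simp add: abs_mult sum_distrib_left)

lemma norm_l1_minus: "norm_l1 (- b) = norm_l1 b"
  unfolding norm_l1_def by simp

lemma norm_l1_split: "norm_l1 b = norm_l1 (restrict_vec b S) + norm_l1 (restrict_vec b (- S))"
  unfolding norm_l1_def restrict_vec_def sum.distrib[symmetric] by (intro sum.cong) auto

lemma norm_l1_diff_ge_active:
  assumes "active_set b \<subseteq> S"
  shows "norm_l1 b - norm_l1 a
    \<le> norm_l1 (restrict_vec (a - b) S) - norm_l1 (restrict_vec (a - b) (- S))"
proof -
  have "b $ j = 0" if "j \<notin> S" for j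
    using assms that by (auto simp: active_set_def)
  then show ?thesis
    unfolding norm_l1_def restrict_vec_def sum_subtractf[symmetric]
    by (intro sum_mono) auto
qed

lemma inner_le_infnorm_norm_l1: "w \<bullet> v \<le> infnorm w * norm_l1 v" for v w :: "real ^ 'p"
proof -
  have "w $ j * v $ j \<le> infnorm w * \<bar>v $ j\<bar>" for j
  proof -
    have "w $ j * v $ j \<le> \<bar>w $ j\<bar> * \<bar>v $ j\<bar>"
      by (metis abs_ge_self abs_mult)
    also have "\<dots> \<le> infnorm w * \<bar>v $ j\<bar>"
      by (intro mult_right_mono component_le_infnorm_cart) auto
    finally show ?thesis .
  qed
  then show ?thesis
    unfolding inner_vec_def norm_l1_def sum_distrib_left by (auto intro: sum_mono)
qed

lemma noise_inner_le:
  fixes X :: "real ^ 'p ^ 'n"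
  assumes "infnorm (e v* X) / real CARD('n) \<le> lam_eps"
  shows "(e \<bullet> (X *v v)) / real CARD('n) \<le> lam_eps * norm_l1 v"
proof -
  have "e \<bullet> (X *v v) = (e v* X) \<bullet> v"
    by (simp add: dot_lmul_matrix)
  also have "\<dots> \<le> infnorm (e v* X) * norm_l1 v"
    by (rule inner_le_infnorm_norm_l1)
  finally have "(e \<bullet> (X *v v)) / real CARD('n) \<le> infnorm (e v* X) / real CARD('n) * norm_l1 v"
    by (simp add: divide_right_mono)
  also have "\<dots> \<le> lam_eps * norm_l1 v"
    using assms norm_l1_nonneg by (rule mult_right_mono)
  finally show ?thesis .
qed

lemma compat_ratio_nonneg: "0 \<le> compat_ratio X L S" if "0 < L"
proof (cases "S = {}")
  case False
  then have "compat_sq X L S \<in> compat_values X L S"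
    using compat_sq_attained that by blast
  then have "0 \<le> compat_sq X L S"
    by (auto simp: compat_values_def)
  then show ?thesis
    by (simp add: compat_ratio_def)
qed (simp add: compat_ratio_def)

text \<open>The vector \<open>b\<close> in the proof carries a minus sign on the
  complement of \<open>S\<close> because the compatibility constant is defined with the difference
  \<open>X *v restrict_vec b S - X *v restrict_vec b (- S)\<close>.\<close>

lemma compat_ratio_bound:
  fixes X :: "real ^ 'p ^ 'n"
  assumes L: "0 < L" and r: "compat_ratio X L S = ereal r"
    and cone: "norm_l1 (restrict_vec w (- S)) \<le> L * norm_l1 (restrict_vec w S)"
  shows "(norm_l1 (restrict_vec w S))\<^sup>2 \<le> r * (norm_n (X *v w))\<^sup>2"
proof (cases "norm_l1 (restrict_vec w S) = 0")
  case True
  have "0 \<le> r"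
    using compat_ratio_nonneg[OF L, of X S] r by simp
  with True show ?thesis
    by simp
next
  case False
  define N where "N = norm_l1 (restrict_vec w S)"
  have N: "0 < N"
    using False norm_l1_nonneg[of "restrict_vec w S"] by (simp add: N_def)
  have S: "S \<noteq> {}"
  proof
    assume "S = {}"
    then have "restrict_vec w S = 0"
      by (simp add: restrict_vec_def vec_eq_iff)
    with False show False
      by (simp add: norm_l1_def)
  qed
  define c where "c = compat_sq X L S"
  note attained = compat_sq_attained[OF S L, of X]
  have "0 \<le> c"
    using attained by (auto simp: c_def compat_values_def)
  moreover have "c \<noteq> 0" and r_eq: "r = real (card S) / c"
    using r S by (auto simp: compat_ratio_def c_def split: if_splits)
  ultimately have c: "0 < c"
    by simp
  define b where "b = (1 / N) *\<^sub>R (restrict_vec w S - restrict_vec w (- S))"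
  have bS: "restrict_vec b S = (1 / N) *\<^sub>R restrict_vec w S"
    by (auto simp: b_def restrict_vec_def vec_eq_iff)
  have bC: "restrict_vec b (- S) = (- 1 / N) *\<^sub>R restrict_vec w (- S)"
    by (auto simp: b_def restrict_vec_def vec_eq_iff)
  have "restrict_vec b S - restrict_vec b (- S) = (1 / N) *\<^sub>R w"
    unfolding bS bC by (auto simp: restrict_vec_def vec_eq_iff)
  then have Xb: "X *v restrict_vec b S - X *v restrict_vec b (- S) = (1 / N) *\<^sub>R (X *v w)"
    by (metis matrix_vector_mult_diff_distrib matrix_vector_mult_scaleR)
  have "norm_l1 (restrict_vec b S) = 1"
    unfolding bS norm_l1_scaleR using N by (simp add: N_def)
  moreover have "norm_l1 (restrict_vec b (- S)) \<le> L"
    unfolding bC norm_l1_scaleR using N cone by (simp add: N_def field_simps)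
  ultimately have "real (card S) * (norm_n ((1 / N) *\<^sub>R (X *v w)))\<^sup>2 \<in> compat_values X L S"
    unfolding compat_values_def Xb[symmetric] by blast
  then have "c \<le> real (card S) * (norm_n ((1 / N) *\<^sub>R (X *v w)))\<^sup>2"
    using attained by (auto simp: c_def)
  also have "\<dots> = real (card S) * (norm_n (X *v w))\<^sup>2 / N\<^sup>2"
    by (simp add: norm_n_sq power2_eq_square[of N])
  finally have "N\<^sup>2 * c \<le> real (card S) * (norm_n (X *v w))\<^sup>2"
    using N by (simp add: field_simps)
  then show ?thesis
    using c by (simp add: r_eq N_def field_simps)
qed

lemma compat_ratio_bound_amgm:
  fixes X :: "real ^ 'p ^ 'n"
  assumes "0 < L" and "compat_ratio X L S = ereal r"
    and "norm_l1 (restrict_vec w (- S)) \<le> L * norm_l1 (restrict_vec w S)"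
  shows "2 * m * norm_l1 (restrict_vec w S) \<le> m\<^sup>2 * r + (norm_n (X *v w))\<^sup>2"
proof -
  define N where "N = norm_l1 (restrict_vec w S)"
  define q where "q = norm_n (X *v w)"
  have le: "N\<^sup>2 \<le> r * q\<^sup>2"
    using compat_ratio_bound[OF assms] by (simp add: N_def q_def)
  have r: "0 \<le> r"
    using compat_ratio_nonneg[OF assms(1), of X S] assms(2) by simp
  have "2 * (m * N) \<le> m\<^sup>2 * r + q\<^sup>2"
  proof (rule power2_le_imp_le)
    have "(2 * (m * N))\<^sup>2 = 4 * m\<^sup>2 * N\<^sup>2"
      by (simp add: power2_eq_square)
    also have "\<dots> \<le> 4 * m\<^sup>2 * (r * q\<^sup>2)"
      using le by (intro mult_left_mono) auto
    also have "\<dots> \<le> (m\<^sup>2 * r + q\<^sup>2)\<^sup>2"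
      using zero_le_power2[of "m\<^sup>2 * r - q\<^sup>2"] by (simp add: power2_eq_square algebra_simps)
    finally show "(2 * (m * N))\<^sup>2 \<le> (m\<^sup>2 * r + q\<^sup>2)\<^sup>2" .
    show "0 \<le> m\<^sup>2 * r + q\<^sup>2"
      using r by simp
  qed
  then show ?thesis
    by (simp add: N_def q_def)
qed

lemma nonneg_of_nonneg_small_perturbation:
  fixes A B :: real
  assumes "\<And>t. 0 < t \<Longrightarrow> t \<le> 1 \<Longrightarrow> 0 \<le> A + t * B"
  shows "0 \<le> A"
proof (rule tendsto_lowerbound)
  show "((\<lambda>t. A + t * B) \<longlongrightarrow> A) (at_right 0)"
    by (auto intro!: tendsto_eq_intros)
  show "\<forall>\<^sub>F t in at_right 0. 0 \<le> A + t * B"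
    using assms by (auto simp: eventually_at_right_field intro!: exI[of _ 1])
qed simp

lemma lasso_variational_inequality:
  fixes X :: "real ^ 'p ^ 'n"
  assumes lasso: "is_lasso X Y lam bhat" and lam: "0 \<le> lam"
  shows "((Y - X *v bhat) \<bullet> (X *v (b - bhat))) / real CARD('n)
    \<le> lam * (norm_l1 b - norm_l1 bhat)"
proof -
  define e where "e = Y - X *v bhat"
  define g where "g = X *v (b - bhat)"
  define n where "n = real CARD('n)"
  have n: "0 < n"
    by (simp add: n_def)
  have "0 \<le> 2 * lam * (norm_l1 b - norm_l1 bhat) - 2 * (e \<bullet> g) / n + t * ((g \<bullet> g) / n)"
    if t: "0 < t" "t \<le> 1" for t
  proof -
    define c where "c = (1 - t) *\<^sub>R bhat + t *\<^sub>R b"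
    have "c = bhat + t *\<^sub>R (b - bhat)"
      by (simp add: c_def algebra_simps)
    then have res: "Y - X *v c = e - t *\<^sub>R g"
      by (simp add: e_def g_def matrix_vector_right_distrib matrix_vector_mult_scaleR)
    have "norm_l1 c \<le> (1 - t) * norm_l1 bhat + t * norm_l1 b"
      using norm_l1_triangle[of "(1 - t) *\<^sub>R bhat" "t *\<^sub>R b"] t by (simp add: c_def norm_l1_scaleR)
    then have "2 * lam * norm_l1 c \<le> 2 * lam * ((1 - t) * norm_l1 bhat + t * norm_l1 b)"
      using lam by (intro mult_left_mono) auto
    moreover have "(norm_n e)\<^sup>2 + 2 * lam * norm_l1 bhat
        \<le> (norm_n (Y - X *v c))\<^sup>2 + 2 * lam * norm_l1 c"
      using lasso by (auto simp: is_lasso_def is_arg_min_linorder e_def)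
    moreover have "(norm_n (Y - X *v c))\<^sup>2 = (norm_n e)\<^sup>2 - 2 * t * (e \<bullet> g) / n + t\<^sup>2 * (g \<bullet> g) / n"
      unfolding res norm_n_sq n_def[symmetric] using n
      by (simp add: inner_diff inner_commute field_simps power2_eq_square)
    ultimately have "0 \<le> t * (2 * lam * (norm_l1 b - norm_l1 bhat) - 2 * (e \<bullet> g) / n + t * ((g \<bullet> g) / n))"
      by (simp add: algebra_simps power2_eq_square)
    then show ?thesis
      using t by (simp add: zero_le_mult_iff)
  qed
  then have "0 \<le> 2 * lam * (norm_l1 b - norm_l1 bhat) - 2 * (e \<bullet> g) / n"
    by (rule nonneg_of_nonneg_small_perturbation)
  then show ?thesis
    by (simp add: e_def g_def n_def)
qed

theorem lasso_oracle_inequality: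
  fixes X :: "real ^ 'p ^ 'n" and b beta0 :: "real ^ 'p"
  assumes lasso: "is_lasso X Y lam betahat" and lam: "0 \<le> lam"
    and noise: "infnorm ((Y - X *v beta0) v* X) / real CARD('n) \<le> lam_eps"
    and less: "lam_eps < lam" and delta: "0 \<le> delta" "delta < 1"
    and m_def: "m = lam + lam_eps + delta * (lam - lam_eps)"
    and L_def: "L = m / ((1 - delta) * (lam - lam_eps))" and L: "0 < L"
    and S: "active_set b \<subseteq> S"
    and r: "compat_ratio X L S = ereal r"
  shows "2 * delta * (lam - lam_eps) * norm_l1 (betahat - b) + (norm_n (X *v (betahat - beta0)))\<^sup>2
    \<le> (norm_n (X *v (b - beta0)))\<^sup>2 + m\<^sup>2 * r"
proof -
  define d where "d = delta * (lam - lam_eps)"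
  define v where "v = betahat - b"
  define u where "u = betahat - beta0"
  define P where "P = norm_l1 (restrict_vec v S)"
  define Q where "Q = norm_l1 (restrict_vec v (- S))"
  define I where "I = ((X *v v) \<bullet> (X *v u)) / real CARD('n)"
  have v_split: "norm_l1 v = P + Q"
    unfolding P_def Q_def by (rule norm_l1_split)
  have r_nonneg: "0 \<le> r"
    using compat_ratio_nonneg[OF L, of X S] r by simp
  have polar: "2 * I = (norm_n (X *v v))\<^sup>2 + (norm_n (X *v u))\<^sup>2 - (norm_n (X *v (b - beta0)))\<^sup>2"
  proof -
    have "X *v (b - beta0) = X *v u - X *v v"
      by (simp add: u_def v_def matrix_vector_mult_diff_distrib)
    then show ?thesis
      unfolding I_def norm_n_sq
      by (simp add: inner_diff inner_commute add_divide_distrib diff_divide_distrib)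
  qed
  have "(Y - X *v betahat) \<bullet> (X *v (b - betahat))
      = (X *v v) \<bullet> (X *v u) - (Y - X *v beta0) \<bullet> (X *v v)"
    by (simp add: u_def v_def matrix_vector_mult_diff_distrib inner_diff inner_commute)
  then have "I \<le> ((Y - X *v beta0) \<bullet> (X *v v)) / real CARD('n) + lam * (norm_l1 b - norm_l1 betahat)"
    using lasso_variational_inequality[OF lasso lam, of b] by (simp add: I_def diff_divide_distrib)
  also have "\<dots> \<le> lam_eps * (P + Q) + lam * (P - Q)"
  proof (intro add_mono mult_left_mono)
    show "((Y - X *v beta0) \<bullet> (X *v v)) / real CARD('n) \<le> lam_eps * (P + Q)"
      using noise_inner_le[OF noise, of v] by (simp add: v_split)
    show "norm_l1 b - norm_l1 betahat \<le> P - Q"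
      using norm_l1_diff_ge_active[OF S, of betahat] by (simp add: P_def Q_def v_def)
  qed (rule lam)
  finally have I: "I + d * (P + Q) \<le> m * P - (1 - delta) * (lam - lam_eps) * Q"
    by (simp add: m_def d_def algebra_simps)
  have "2 * d * norm_l1 v + (norm_n (X *v u))\<^sup>2 \<le> (norm_n (X *v (b - beta0)))\<^sup>2 + m\<^sup>2 * r"
  proof (cases "I + d * (P + Q) \<le> 0")
    case True
    moreover have "0 \<le> m\<^sup>2 * r" "0 \<le> (norm_n (X *v v))\<^sup>2"
      using r_nonneg by auto
    ultimately show ?thesis
      using polar unfolding v_split by linarith
  next
    case False
    have k: "0 < (1 - delta) * (lam - lam_eps)"
      using delta less by simp
    have "(1 - delta) * (lam - lam_eps) * Q \<le> m * P"
      using False I by linarith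
    then have "Q \<le> L * P"
      using k by (simp add: L_def pos_le_divide_eq mult.commute)
    then have "2 * m * P \<le> m\<^sup>2 * r + (norm_n (X *v v))\<^sup>2"
      unfolding P_def Q_def by (rule compat_ratio_bound_amgm[OF L r])
    moreover have "0 \<le> (1 - delta) * (lam - lam_eps) * Q"
      unfolding Q_def using k by (intro mult_nonneg_nonneg[OF less_imp_le norm_l1_nonneg])
    ultimately show ?thesis
      using polar I unfolding v_split by linarith
  qed
  then show ?thesis
    by (simp add: d_def u_def v_def)
qed

lemma norm_l1_diff_le_of_norm_l1_le:
  fixes X :: "real ^ 'p ^ 'n" and b beta0 :: "real ^ 'p"
  assumes le: "norm_l1 beta0 \<le> norm_l1 b" and L: "1 \<le> L" and m: "0 \<le> m"
    and S: "active_set b \<subseteq> S" and r: "compat_ratio X L S = ereal r"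
  shows "m * norm_l1 (b - beta0) \<le> (norm_n (X *v (b - beta0)))\<^sup>2 + m\<^sup>2 * r"
proof -
  define w where "w = beta0 - b"
  define P where "P = norm_l1 (restrict_vec w S)"
  define Q where "Q = norm_l1 (restrict_vec w (- S))"
  have QP: "Q \<le> P"
    using norm_l1_diff_ge_active[OF S, of beta0] le by (simp add: w_def P_def Q_def)
  also have "P \<le> L * P"
    using mult_right_mono[OF L, of P] norm_l1_nonneg[of "restrict_vec w S"] by (simp add: P_def)
  finally have "2 * m * P \<le> m\<^sup>2 * r + (norm_n (X *v w))\<^sup>2"
    unfolding P_def Q_def using L by (intro compat_ratio_bound_amgm[OF _ r]) auto
  moreover have "norm_l1 (b - beta0) = P + Q"
    using norm_l1_split[of w S] norm_l1_minus[of w] by (simp add: w_def P_def Q_def)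
  then have "m * norm_l1 (b - beta0) \<le> 2 * m * P"
    using mult_left_mono[OF QP m] by (simp add: algebra_simps)
  moreover have "X *v (b - beta0) = - (X *v w)"
    by (simp add: w_def matrix_vector_mult_diff_distrib)
  then have "(norm_n (X *v (b - beta0)))\<^sup>2 = (norm_n (X *v w))\<^sup>2"
    by (simp add: norm_n_sq)
  ultimately show ?thesis
    by linarith
qed

theorem corollary1p3p1:
  fixes X :: "real ^ 'p ^ 'n"
    and Y f0 eps :: "real ^ 'n"
    and beta0 betahat betastar :: "real ^ 'p"
    and lam lam_eps delta L lam_star :: real
  assumes "rank X = CARD('n)"
    and "X *v beta0 = f0"
    and "eps = Y - f0"
    and "lam > 0"
    and "is_lasso X Y lam betahat"
    and "lam_eps \<ge> infnorm (eps v* X) / real CARD('n)"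
    and "0 \<le> delta" and "delta < 1"
    and "lam > lam_eps"
    and "L = (lam + lam_eps + delta * (lam - lam_eps)) / ((1 - delta) * (lam - lam_eps))"
    and "lam_star = lam + lam_eps + delta * (lam - lam_eps)"
    and "is_arg_min
           (\<lambda>b. ereal ((norm_n (X *v (b - beta0)))\<^sup>2)
                + ereal (lam_star\<^sup>2) * compat_ratio X L (active_set b))
           (\<lambda>b. norm_l1 b \<ge> norm_l1 beta0) betastar"
  shows "ereal (2 * delta * (lam - lam_eps) * norm_l1 (betahat - beta0)
                + (norm_n (X *v (betahat - beta0)))\<^sup>2)
         \<le> ereal ((lam + lam_eps + 3 * delta * (lam - lam_eps))
                    / (lam + lam_eps + delta * (lam - lam_eps))
                  * (norm_n (X *v (betastar - beta0)))\<^sup>2)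
           + ereal ((lam + lam_eps + 3 * delta * (lam - lam_eps))
                    * (lam + lam_eps + delta * (lam - lam_eps)))
             * compat_ratio X L (active_set betastar)"
proof -
  define d where "d = delta * (lam - lam_eps)"
  define S where "S = active_set betastar"
  define E0 where "E0 = (norm_n (X *v (betastar - beta0)))\<^sup>2"
  have "0 \<le> infnorm (eps v* X) / real CARD('n)"
    by (simp add: infnorm_pos_le)
  then have lam_eps: "0 \<le> lam_eps"
    using assms(6) by linarith
  have d: "0 \<le> d"
    using assms(7,9) by (simp add: d_def)
  have m: "lam_star = lam + lam_eps + d"
    using assms(11) by (simp add: d_def)
  have m_pos: "0 < lam_star"
    using m d lam_eps assms(4) by linarith
  have L_def: "L = lam_star / ((1 - delta) * (lam - lam_eps))"
    using assms(10,11) by simp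
  have k: "0 < (1 - delta) * (lam - lam_eps)"
    using assms(8,9) by simp
  have "(1 - delta) * (lam - lam_eps) = lam - lam_eps - d"
    by (simp add: d_def algebra_simps)
  then have "(1 - delta) * (lam - lam_eps) \<le> lam_star"
    using m d lam_eps by linarith
  then have L: "1 \<le> L"
    using k by (simp add: L_def)
  have constraint: "norm_l1 beta0 \<le> norm_l1 betastar"
    using assms(12) by (simp add: is_arg_min_def)
  define C where "C = lam + lam_eps + 3 * delta * (lam - lam_eps)"
  have C: "C = lam_star + 2 * d"
    by (simp add: C_def m d_def)
  have C_pos: "0 < C"
    using C m_pos d by linarith
  have goal: "ereal (2 * d * norm_l1 (betahat - beta0) + (norm_n (X *v (betahat - beta0)))\<^sup>2)
      \<le> ereal (C / lam_star * E0) + ereal (C * lam_star) * compat_ratio X L S"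
  proof (cases "compat_ratio X L S")
    case (real r)
    have noise: "infnorm ((Y - X *v beta0) v* X) / real CARD('n) \<le> lam_eps"
      using assms(2,3,6) by simp
    have center_betastar: "2 * d * norm_l1 (betahat - betastar) + (norm_n (X *v (betahat - beta0)))\<^sup>2
        \<le> E0 + lam_star\<^sup>2 * r"
      using lasso_oracle_inequality[OF assms(5) _ noise assms(9,7,8,11) L_def _ _ real, of betastar]
        assms(4) L by (simp add: d_def E0_def S_def mult.assoc)
    have "lam_star * norm_l1 (betastar - beta0) \<le> E0 + lam_star\<^sup>2 * r"
      using norm_l1_diff_le_of_norm_l1_le[OF constraint L _ _ real] m_pos
      by (simp add: E0_def S_def)
    then have "norm_l1 (betastar - beta0) \<le> (E0 + lam_star\<^sup>2 * r) / lam_star"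
      using m_pos by (simp add: pos_le_divide_eq mult.commute)
    then have shift: "2 * d * norm_l1 (betastar - beta0)
        \<le> 2 * d * ((E0 + lam_star\<^sup>2 * r) / lam_star)"
      using d by (intro mult_left_mono) auto
    have "norm_l1 (betahat - beta0) \<le> norm_l1 (betahat - betastar) + norm_l1 (betastar - beta0)"
      using norm_l1_triangle[of "betahat - betastar" "betastar - beta0"] by simp
    then have "2 * d * norm_l1 (betahat - beta0)
        \<le> 2 * d * (norm_l1 (betahat - betastar) + norm_l1 (betastar - beta0))"
      using d by (intro mult_left_mono) auto
    then have "2 * d * norm_l1 (betahat - beta0) + (norm_n (X *v (betahat - beta0)))\<^sup>2
        \<le> (E0 + lam_star\<^sup>2 * r) + 2 * d * ((E0 + lam_star\<^sup>2 * r) / lam_star)"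
      using center_betastar shift by (simp add: distrib_left)
    also have "\<dots> = C / lam_star * E0 + C * lam_star * r"
      using m_pos by (simp add: C field_simps power2_eq_square)
    finally show ?thesis
      by (simp add: real)
  next
    case PInf
    then show ?thesis
      using C_pos m_pos by simp
  next
    case MInf
    then show ?thesis
      using compat_ratio_nonneg[of L X S] L by simp
  qed
  show ?thesis
    using goal by (simp add: C_def d_def E0_def S_def assms(11) mult.assoc)
qed

end
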